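(* Let $T>0$, $\bar\theta\in[0,1]$, and let $c,\psi$ satisfy the standing assumptions in the context. There exists a solution $(u,\theta)$, with $u:\{0,1\}\times[0,T]\to\mathbb{R}$ and $\theta:[0,T]\to[0,1]$, of the system $$\begin{cases}-\dfrac{d}{dt}u(i,t)=h(u(1-i,t)-u(i,t),\theta(t),i),\quad i\in\{0,1\},\\[2mm] \dfrac{d\theta}{dt}=(1-\theta)\,\alpha^*(u(0,t)-u(1,t),\theta,1)-\theta\,\alpha^*(u(1,t)-u(0,t),\theta,0),\end{cases}$$ satisfying the initial-terminal conditions $u(i,T)=\psi(i,\theta(T))$ for $i\in\{0,1\}$ and $\theta(0)=\bar\theta$.
   Context: Standing assumptions on costs. $c:\{0,1\}\times[0,1]\times[0,\infty)\to\mathbb{R}$, $(i,\theta,\alpha)\mapsto c(i,\theta,\alpha)$, and $\psi:\{0,1\}\times[0,1]\to\mathbb{R}$ are non-negative and Lipschitz in $\theta$ (for each fixed value of the other variables). $c$ is differentiable in $\alpha$, with derivative $c'(i,\theta,\alpha)$ (one-sided at $\alpha=0$), and $c'$ is Lipschitz in $\theta$ with a constant independent of $(i,\alpha)$. $c$ is uniformly convex in $\alpha$: there is $\kappa>0$ with $c(i,\theta,\alpha')\ge c(i,\theta,\alpha)+c'(i,\theta,\alpha)(\alpha'-\alpha)+\kappa|\alpha'-\alpha|^2$ for all $i,\theta$ and $\alpha,\alpha'\ge0$; and $c$ is superlinear in $\alpha$ (i.e. $c(i,\theta,\alpha)/\alpha\to\infty$ as $\alpha\to\infty$). For $p\in\mathbb{R}$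 put $h(p,\theta,i)=\min_{\alpha\ge0}[c(i,\theta,\alpha)+\alpha p]$ and let $\alpha^*(p,\theta,i)$ be the unique minimizer. *)

theory Defs
  imports "HOL-Analysis.Analysis"
begin

text \<open>
  The state space \<open>{0,1}\<close> is a subset of \<^typ>\<open>nat\<close>, so that the other state is \<open>1 - i\<close>.
  All functions are total; only their values for \<open>i \<in> {0,1}\<close>, \<open>\<theta> \<in> {0..1}\<close> and
  \<open>\<alpha> \<ge> 0\<close> are constrained or used. The derivative \<open>c'\<close> is taken within \<open>{0..}\<close>,
  hence is one-sided at \<open>\<alpha> = 0\<close>, and is determined by \<open>c\<close> on this domain. The Lipschitz
  constants of \<open>c\<close> and \<open>\<psi>\<close> may depend on the frozen variables, the one of \<open>c'\<close> may not.
\<close>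

locale two_state_costs =
  fixes c c' :: "nat \<Rightarrow> real \<Rightarrow> real \<Rightarrow> real"
    and \<psi> :: "nat \<Rightarrow> real \<Rightarrow> real"
  assumes c_nonneg:
      "\<And>i \<theta> \<alpha>. i \<in> {0,1} \<Longrightarrow> \<theta> \<in> {0..1} \<Longrightarrow> \<alpha> \<ge> 0 \<Longrightarrow> c i \<theta> \<alpha> \<ge> 0"
    and psi_nonneg:
      "\<And>i \<theta>. i \<in> {0,1} \<Longrightarrow> \<theta> \<in> {0..1} \<Longrightarrow> \<psi> i \<theta> \<ge> 0"
    and c_lipschitz:
      "\<And>i \<alpha>. i \<in> {0,1} \<Longrightarrow> \<alpha> \<ge> 0 \<Longrightarrow> \<exists>L. L-lipschitz_on {0..1} (\<lambda>\<theta>. c i \<theta> \<alpha>)"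
    and psi_lipschitz:
      "\<And>i. i \<in> {0,1} \<Longrightarrow> \<exists>L. L-lipschitz_on {0..1} (\<psi> i)"
    and c_deriv:
      "\<And>i \<theta> \<alpha>. i \<in> {0,1} \<Longrightarrow> \<theta> \<in> {0..1} \<Longrightarrow> \<alpha> \<ge> 0 \<Longrightarrow>
         (c i \<theta> has_real_derivative c' i \<theta> \<alpha>) (at \<alpha> within {0..})"
    and c'_lipschitz:
      "\<exists>L. \<forall>i\<in>{0,1}. \<forall>\<alpha>\<ge>0. L-lipschitz_on {0..1} (\<lambda>\<theta>. c' i \<theta> \<alpha>)"
    and c_uniformly_convex:
      "\<exists>\<kappa>>0. \<forall>i\<in>{0,1}. \<forall>\<theta>\<in>{0..1}. \<forall>\<alpha>\<ge>0. \<forall>\<alpha>'\<ge>0.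
         c i \<theta> \<alpha>' \<ge> c i \<theta> \<alpha> + c' i \<theta> \<alpha> * (\<alpha>' - \<alpha>) + \<kappa> * \<bar>\<alpha>' - \<alpha>\<bar>\<^sup>2"
    and c_superlinear:
      "\<And>i \<theta>. i \<in> {0,1} \<Longrightarrow> \<theta> \<in> {0..1} \<Longrightarrow>
         filterlim (\<lambda>\<alpha>. c i \<theta> \<alpha> / \<alpha>) at_top at_top"

text \<open>
  \<open>LEAST\<close> and \<open>THE\<close> are unspecified where no minimum, or no unique minimizer, exists; the
  lemmas below show that this does not happen under the assumptions of
  \<^locale>\<open>two_state_costs\<close>.
\<close>

definition hamiltonian :: "(nat \<Rightarrow> real \<Rightarrow> real \<Rightarrow> real) \<Rightarrow> real \<Rightarrow> real \<Rightarrow> nat \<Rightarrow> real" where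
  "hamiltonian c p \<theta> i = (LEAST y. y \<in> (\<lambda>\<alpha>. c i \<theta> \<alpha> + \<alpha> * p) ` {0..})"

definition alpha_star :: "(nat \<Rightarrow> real \<Rightarrow> real \<Rightarrow> real) \<Rightarrow> real \<Rightarrow> real \<Rightarrow> nat \<Rightarrow> real" where
  "alpha_star c p \<theta> i = (THE \<alpha>. is_arg_min (\<lambda>\<alpha>. c i \<theta> \<alpha> + \<alpha> * p) (\<lambda>\<alpha>. \<alpha> \<ge> 0) \<alpha>)"

context two_state_costs
begin

lemma ex1_minimizer:
  assumes i: "i \<in> {0,1}" and th: "\<theta> \<in> {0..1}"
  shows "\<exists>!\<alpha>. is_arg_min (\<lambda>\<alpha>. c i \<theta> \<alpha> + \<alpha> * p) (\<lambda>\<alpha>. \<alpha> \<ge> 0) \<alpha>"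
proof -
  define f where "f = (\<lambda>\<alpha>. c i \<theta> \<alpha> + \<alpha> * p)"
  have "eventually (\<lambda>\<alpha>. c i \<theta> \<alpha> / \<alpha> \<ge> c i \<theta> 0 + 1 + \<bar>p\<bar>) at_top"
    using c_superlinear[OF i th] by (simp add: filterlim_at_top)
  then obtain N where N: "\<And>\<alpha>. \<alpha> \<ge> N \<Longrightarrow> c i \<theta> \<alpha> / \<alpha> \<ge> c i \<theta> 0 + 1 + \<bar>p\<bar>"
    by (auto simp: eventually_at_top_linorder)
  define R where "R = max N 1"
  have far: "f \<alpha> \<ge> f 0" if "\<alpha> \<ge> R" for \<alpha>
  proof -
    have a1: "\<alpha> \<ge> 1" and aN: "\<alpha> \<ge> N" using that by (auto simp: R_def)
    have c0: "c i \<theta> 0 \<ge> 0" using c_nonneg[OF i th] by simp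
    have "c i \<theta> \<alpha> \<ge> (c i \<theta> 0 + 1 + \<bar>p\<bar>) * \<alpha>"
      using N[OF aN] a1 by (simp add: pos_le_divide_eq)
    moreover have "c i \<theta> 0 * \<alpha> \<ge> c i \<theta> 0"
      using mult_left_mono[OF a1 c0] by simp
    moreover have "\<alpha> * p \<ge> - (\<bar>p\<bar> * \<alpha>)"
      using a1 mult_left_mono[of "-p" "\<bar>p\<bar>" \<alpha>, OF abs_ge_minus_self]
      by (simp add: algebra_simps)
    ultimately show ?thesis using a1 unfolding f_def by (simp add: algebra_simps)
  qed
  have "continuous_on {0..} (c i \<theta>)"
    using c_deriv[OF i th] by (intro DERIV_continuous_on) auto
  then have "continuous_on {0..R} f"
    unfolding f_def by (intro continuous_intros) (auto elim: continuous_on_subset)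
  moreover have "R \<ge> 1" by (simp add: R_def)
  ultimately obtain a where a: "a \<in> {0..R}" "\<And>x. x \<in> {0..R} \<Longrightarrow> f a \<le> f x"
    using continuous_attains_inf[of "{0..R}" f] by force
  have min: "f a \<le> f x" if "x \<ge> 0" for x
    using a(2)[of x] a(2)[of 0] far[of x] that \<open>R \<ge> 1\<close> by (cases "x \<le> R") auto
  obtain \<kappa> where k: "\<kappa> > 0" and cvx: "\<And>x y. x \<ge> 0 \<Longrightarrow> y \<ge> 0 \<Longrightarrow>
      c i \<theta> y \<ge> c i \<theta> x + c' i \<theta> x * (y - x) + \<kappa> * \<bar>y - x\<bar>\<^sup>2"
    using c_uniformly_convex i th by meson
  have uniq: "b = a" if b: "b \<ge> 0" "\<And>x. x \<ge> 0 \<Longrightarrow> f b \<le> f x" for b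
  proof (rule ccontr)
    assume ne: "b \<noteq> a"
    define m where "m = (a + b) / 2"
    have m0: "m \<ge> 0" using a b by (simp add: m_def)
    have d: "a - m = - (b - m)" by (simp add: m_def field_simps)
    define D where "D = c' i \<theta> m * (b - m)"
    define Q where "Q = \<kappa> * (b - m)\<^sup>2"
    have "f a + f b \<ge> 2 * f m + 2 * Q"
    proof -
      have "c i \<theta> a \<ge> c i \<theta> m - D + Q"
        using cvx[OF m0, of a] a(1) unfolding d D_def Q_def
        by (simp add: algebra_simps power2_commute[of b m])
      moreover have "c i \<theta> b \<ge> c i \<theta> m + D + Q"
        using cvx[OF m0 b(1)] by (simp add: D_def Q_def)
      moreover have "a * p + b * p = 2 * (m * p)" by (simp add: m_def algebra_simps)
      ultimately show ?thesis unfolding f_def by argo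
    qed
    moreover have "Q > 0" using k ne by (simp add: Q_def m_def field_simps)
    ultimately show False using min[OF m0] b(2)[OF m0] by linarith
  qed
  have "is_arg_min f (\<lambda>\<alpha>. \<alpha> \<ge> 0) a"
    using a(1) min by (auto simp: is_arg_min_linorder)
  moreover have "b = a" if "is_arg_min f (\<lambda>\<alpha>. \<alpha> \<ge> 0) b" for b
    using that uniq by (auto simp: is_arg_min_linorder)
  ultimately show ?thesis unfolding f_def by blast
qed

lemma alpha_star_minimizer:
  assumes "i \<in> {0,1}" "\<theta> \<in> {0..1}"
  shows "is_arg_min (\<lambda>\<alpha>. c i \<theta> \<alpha> + \<alpha> * p) (\<lambda>\<alpha>. \<alpha> \<ge> 0) (alpha_star c p \<theta> i)"
  unfolding alpha_star_def by (rule theI'[OF ex1_minimizer[OF assms]])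

lemma hamiltonian_eq:
  assumes "i \<in> {0,1}" "\<theta> \<in> {0..1}"
  shows "hamiltonian c p \<theta> i = c i \<theta> (alpha_star c p \<theta> i) + alpha_star c p \<theta> i * p"
  unfolding hamiltonian_def
  using alpha_star_minimizer[OF assms, of p]
  by (intro Least_equality) (auto simp: is_arg_min_linorder)

end

end

theory Submission imports Defs begin

text \<open>
  In reversed time the system is an autonomous ODE for \<open>(u 0, u 1, \<theta>)\<close> whose initial value is
  determined by \<open>x = \<theta> T\<close>. Truncating \<open>u\<close> to \<open>{0..M}\<close> and \<open>\<theta>\<close> to \<open>{0..1}\<close> in the right-hand side
  makes it globally Lipschitz, so that it has a flow which is continuous in \<open>x\<close>; its third
  component changes by at most \<open>K * T\<close>, so the intermediate value theorem gives an \<open>x\<close> for which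
  \<open>\<theta>\<close> takes the prescribed value at time \<open>0\<close>. For the corresponding trajectory the signs of the
  right-hand side on the boundary of the truncation region keep \<open>\<theta>\<close> in \<open>{0..1}\<close> and then \<open>u\<close> in
  \<open>{0..M}\<close>, so the truncation is inactive.
\<close>

section \<open>Preliminaries: a sign criterion, truncation, reflection of time\<close>

text \<open>After the last time \<open>s\<close> before \<open>t\<close> with
  \<open>f s \<ge> 0\<close> the function would stay negative, hence be nondecreasing, and could not
  end below \<open>f s\<close>. This is the barrier argument that later confines \<theta> and
  \<open>u\<close> to the truncation region.\<close>

lemma nonneg_if_derivative_nonneg_where_negative:
  fixes f f' :: "real \<Rightarrow> real"
  assumes deriv: "\<And>t. t \<in> {0..T} \<Longrightarrow> (f has_real_derivative f' t) (at t within {0..T})"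
    and sign: "\<And>t. t \<in> {0..T} \<Longrightarrow> f t < 0 \<Longrightarrow> f' t \<ge> 0"
    and init: "f 0 \<ge> 0" and t: "t \<in> {0..T}"
  shows "f t \<ge> 0"
proof (rule ccontr)
  assume neg: "\<not> f t \<ge> 0"
  define S where "S = {0..t} \<inter> f -` {0..}"
  have cont: "continuous_on {0..T} f"
    using deriv by (intro DERIV_continuous_on) auto
  then have "continuous_on {0..t} f"
    by (rule continuous_on_subset) (use t in auto)
  then have "closed S"
    unfolding S_def by (intro continuous_closed_preimage) auto
  then have "compact S"
    unfolding S_def by (meson bounded_Int bounded_closed_interval compact_eq_bounded_closed)
  moreover have "0 \<in> S" using init t by (auto simp: S_def)
  ultimately obtain s where s: "s \<in> S" "\<And>x. x \<in> S \<Longrightarrow> x \<le> s"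
    using compact_attains_sup[of S] by auto
  have st: "0 \<le> s" "s < t" "f s \<ge> 0"
    using s(1) neg by (auto simp: S_def less_le)
  have "continuous_on {s..t} f"
    using cont by (rule continuous_on_subset) (use st t in auto)
  moreover have der: "(f has_real_derivative f' x) (at x)" if "s < x" "x < t" for x
  proof -
    have "at x within {0..T} = at x"
      using that st t by (intro at_within_interior) (auto simp: interior_atLeastAtMost_real)
    then show ?thesis using deriv[of x] that st t by auto
  qed
  ultimately obtain l z where z: "s < z" "z < t" "DERIV f z :> l" "f t - f s = (t - s) * l"
    using MVT[of s t f] st real_differentiable_def by metis
  have "l = f' z" using DERIV_unique[OF z(3) der[OF z(1,2)]] .
  moreover have "f z < 0"
    using s(2)[of z] z st by (force simp: S_def)
  ultimately have "l \<ge> 0" using sign[of z] z st t by auto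
  then have "(t - s) * l \<ge> 0" using st by simp
  then show False using z(4) st neg by linarith
qed

lemma lipschitz_on_mult_bounded:
  fixes f g :: "'a::metric_space \<Rightarrow> real"
  assumes f: "L-lipschitz_on S f" and g: "M-lipschitz_on S g"
    and fb: "\<And>x. x \<in> S \<Longrightarrow> \<bar>f x\<bar> \<le> A" and gb: "\<And>x. x \<in> S \<Longrightarrow> \<bar>g x\<bar> \<le> B"
    and "A \<ge> 0" "B \<ge> 0"
  shows "(A * M + B * L)-lipschitz_on S (\<lambda>x. f x * g x)"
proof (rule lipschitz_onI)
  show "0 \<le> A * M + B * L"
    using assms lipschitz_on_nonneg[OF f] lipschitz_on_nonneg[OF g] by simp
  fix x y assume xy: "x \<in> S" "y \<in> S"
  have "\<bar>f x * g x - f y * g y\<bar> = \<bar>f x * (g x - g y) + g y * (f x - f y)\<bar>"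
    by (simp add: algebra_simps)
  also have "\<dots> \<le> \<bar>f x\<bar> * \<bar>g x - g y\<bar> + \<bar>g y\<bar> * \<bar>f x - f y\<bar>"
    by (metis abs_mult abs_triangle_ineq)
  also have "\<dots> \<le> A * (M * dist x y) + B * (L * dist x y)"
    using lipschitz_onD[OF f xy] lipschitz_onD[OF g xy] fb[OF xy(1)] gb[OF xy(2)] \<open>A \<ge> 0\<close> \<open>B \<ge> 0\<close>
    by (intro add_mono mult_mono) (auto simp: dist_real_def)
  finally show "dist (f x * g x) (f y * g y) \<le> (A * M + B * L) * dist x y"
    by (simp add: dist_real_def algebra_simps)
qed

definition truncate :: "real \<Rightarrow> real \<Rightarrow> real \<Rightarrow> real" where
  "truncate a b x = max a (min b x)"

lemma truncate_in: "a \<le> b \<Longrightarrow> truncate a b x \<in> {a..b}"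
  by (auto simp: truncate_def)

lemma truncate_id: "x \<in> {a..b} \<Longrightarrow> truncate a b x = x"
  by (auto simp: truncate_def)

lemma truncate_below: "a \<le> b \<Longrightarrow> x \<le> a \<Longrightarrow> truncate a b x = a"
  by (auto simp: truncate_def)

lemma truncate_above: "a \<le> b \<Longrightarrow> b \<le> x \<Longrightarrow> truncate a b x = b"
  by (auto simp: truncate_def)

lemma lipschitz_on_truncate:
  assumes "L-lipschitz_on S f"
  shows "L-lipschitz_on S (\<lambda>x. truncate a b (f x))"
proof (rule lipschitz_onI)
  show "0 \<le> L" by (rule lipschitz_on_nonneg[OF assms])
  fix x y assume "x \<in> S" "y \<in> S"
  have "dist (truncate a b (f x)) (truncate a b (f y)) \<le> dist (f x) (f y)"
    by (auto simp: truncate_def dist_real_def max_def min_def)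
  also have "\<dots> \<le> L * dist x y" using lipschitz_onD[OF assms] \<open>x \<in> S\<close> \<open>y \<in> S\<close> .
  finally show "dist (truncate a b (f x)) (truncate a b (f y)) \<le> L * dist x y" .
qed

text \<open>Undoes the time reversal. The reflection maps \<open>{0..T}\<close> onto itself, so the
  one-sided derivatives at the two endpoints are exchanged.\<close>

lemma has_real_derivative_reflect:
  fixes f f' :: "real \<Rightarrow> real"
  assumes "\<And>t. t \<in> {0..T} \<Longrightarrow> (f has_real_derivative f' t) (at t within {0..T})" and t: "t \<in> {0..T}"
  shows "((\<lambda>t. f (T - t)) has_real_derivative - f' (T - t)) (at t within {0..T})"
proof -
  have "(f has_real_derivative f' (T - t)) (at (T - t) within (\<lambda>t. T - t) ` {0..T})"
    by (rule DERIV_subset[OF assms(1)]) (use t in auto)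
  moreover have "((\<lambda>t. T - t) has_real_derivative -1) (at t within {0..T})"
    by (auto intro!: derivative_eq_intros)
  ultimately show ?thesis
    using DERIV_image_chain[of f "f' (T - t)" "\<lambda>t. T - t" t "{0..T}" "-1"] by (simp add: o_def)
qed

lemma lipschitz_on_two_states_bounded_above:
  fixes f :: "nat \<Rightarrow> real \<Rightarrow> real"
  assumes "\<And>i. i \<in> {0,1} \<Longrightarrow> \<exists>L. L-lipschitz_on {0..1} (f i)"
  shows "\<exists>C. \<forall>i\<in>{0,1}. \<forall>\<theta>\<in>{0..1}. f i \<theta> \<le> C"
proof -
  have "compact (f i ` {0..1})" if "i \<in> {0,1}" for i
    using assms[OF that] by (blast intro: compact_continuous_image lipschitz_on_continuous_on)
  then have "bounded (\<Union>i\<in>{0,1}. f i ` {0..1})"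
    by (intro bounded_UN finite.intros ballI compact_imp_bounded)
  then obtain C where "\<forall>y\<in>(\<Union>i\<in>{0,1}. f i ` {0..1}). \<bar>y\<bar> \<le> C"
    by (auto simp: bounded_iff)
  then have "\<forall>i\<in>{0,1}. \<forall>\<theta>\<in>{0..1}. f i \<theta> \<le> C"
    by (meson UN_I abs_le_D1 imageI)
  then show ?thesis by blast
qed

subsection \<open>Flows of Lipschitz vector fields\<close>

text \<open>The bound on the integrands is the derivative of \<open>B * exp (k * s)\<close>, so
  exponential estimates reproduce themselves under integration. It serves with
  \<open>k = 2 * L\<close> for the contraction and with \<open>k = L\<close> for the dependence on
  the initial value.\<close>

lemma dist_integral_le_exp:
  fixes f g :: "real \<Rightarrow> 'a::banach"
  assumes f: "continuous_on {0..t} f" and g: "continuous_on {0..t} g" and "t \<ge> 0"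
    and le: "\<And>s. s \<in> {0..t} \<Longrightarrow> dist (f s) (g s) \<le> B * (k * exp (k * s))"
  shows "dist (integral {0..t} f) (integral {0..t} g) \<le> B * (exp (k * t) - 1)"
proof -
  have I: "((\<lambda>s. B * (k * exp (k * s))) has_integral B * exp (k * t) - B * exp (k * 0)) {0..t}"
    by (rule fundamental_theorem_of_calculus[OF \<open>t \<ge> 0\<close>])
      (auto intro!: derivative_eq_intros simp flip: has_real_derivative_iff_has_vector_derivative)
  have int: "f integrable_on {0..t}" "g integrable_on {0..t}"
    using f g by (auto intro: integrable_continuous_interval)
  have "dist (integral {0..t} f) (integral {0..t} g) = norm (integral {0..t} (\<lambda>s. f s - g s))"
    using int by (simp add: dist_norm integral_diff)
  also have "\<dots> \<le> integral {0..t} (\<lambda>s. B * (k * exp (k * s)))"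
    using int I le by (intro integral_norm_bound_integral integrable_diff) (auto simp: dist_norm)
  also have "\<dots> = B * (exp (k * t) - 1)"
    unfolding integral_unique[OF I] by (simp add: algebra_simps)
  finally show ?thesis .
qed

primrec picard_iterate :: "('a::banach \<Rightarrow> 'a) \<Rightarrow> 'a \<Rightarrow> nat \<Rightarrow> real \<Rightarrow> 'a" where
  "picard_iterate F x 0 = (\<lambda>t. x)"
| "picard_iterate F x (Suc n) = (\<lambda>t. x + integral {0..t} (\<lambda>s. F (picard_iterate F x n s)))"

context
  fixes F :: "'a::banach \<Rightarrow> 'a" and L T :: real
  assumes F: "L-lipschitz_on UNIV F"
begin

lemma continuous_on_picard_iterate: "continuous_on {0..T} (picard_iterate F x n)"
proof (induction n)
  case (Suc n)
  have "continuous_on {0..T} (\<lambda>s. F (picard_iterate F x n s))"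
    using continuous_on_compose2[OF lipschitz_on_continuous_on[OF F] Suc] by auto
  then show ?case
    by (auto intro!: continuous_intros indefinite_integral_continuous_1 integrable_continuous_interval)
qed simp

lemma continuous_on_lipschitz_picard_iterate:
  assumes "t \<in> {0..T}"
  shows "continuous_on {0..t} (\<lambda>s. F (picard_iterate F x n s))"
  by (rule continuous_on_subset[OF continuous_on_compose2[OF lipschitz_on_continuous_on[OF F]
        continuous_on_picard_iterate]]) (use assms in auto)

text \<open>The weight \<open>exp (2 * L * t)\<close> gives the contraction factor \<open>1/2\<close> on the whole interval.\<close>

lemma picard_iterate_contraction:
  assumes "L > 0" "t \<in> {0..T}"
  shows "dist (picard_iterate F x (Suc n) t) (picard_iterate F x n t)
           \<le> norm (F x) * T * (1/2) ^ n * exp (2 * L * t)"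
  using assms(2)
proof (induction n arbitrary: t)
  case 0
  have "t * norm (F x) \<le> norm (F x) * T" using 0 mult_right_mono[of t T "norm (F x)"] by (simp add: mult.commute)
  also have "\<dots> \<le> norm (F x) * T * exp (2 * L * t)"
    using 0 \<open>L > 0\<close> mult_left_mono[of 1 "exp (2 * L * t)" "norm (F x) * T"] by simp
  finally show ?case using 0 by (simp add: dist_norm)
next
  case (Suc n)
  let ?P = "picard_iterate F x" and ?C = "norm (F x) * T"
  have C: "?C \<ge> 0" using Suc.prems by simp
  \<comment> \<open>The Lipschitz constant is split as \<open>L = 1/2 * (2 * L)\<close>: the half is
    the contraction factor, and \<open>2 * L\<close> completes the derivative of the weight.\<close>
  have bd: "dist (F (?P (Suc n) s)) (F (?P n s))
      \<le> ?C * (1/2) ^ Suc n * ((2 * L) * exp ((2 * L) * s))" if "s \<in> {0..t}" for s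
  proof -
    have "dist (F (?P (Suc n) s)) (F (?P n s)) \<le> L * dist (?P (Suc n) s) (?P n s)"
      using lipschitz_onD[OF F] by auto
    also have "\<dots> \<le> L * (?C * (1/2) ^ n * exp (2 * L * s))"
      using Suc.IH[of s] that Suc.prems \<open>L > 0\<close> by (intro mult_left_mono) auto
    finally show ?thesis by (simp add: algebra_simps)
  qed
  have "dist (?P (Suc (Suc n)) t) (?P (Suc n) t) =
      dist (integral {0..t} (\<lambda>s. F (?P (Suc n) s))) (integral {0..t} (\<lambda>s. F (?P n s)))"
    by (simp only: picard_iterate.simps dist_add_cancel)
  also have "\<dots> \<le> ?C * (1/2) ^ Suc n * (exp ((2 * L) * t) - 1)"
    using Suc.prems bd
    by (intro dist_integral_le_exp continuous_on_lipschitz_picard_iterate) auto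
  also have "\<dots> \<le> ?C * (1/2) ^ Suc n * exp (2 * L * t)"
    using C by (intro mult_left_mono) auto
  finally show ?case .
qed

text \<open>A Gronwall bound proved directly for the iterates. It is uniform in \<open>n\<close>, so
  it passes to the limit and makes the flow continuous in its initial value.\<close>

lemma picard_iterate_lipschitz:
  assumes "t \<in> {0..T}"
  shows "dist (picard_iterate F x n t) (picard_iterate F y n t) \<le> dist x y * exp (L * t)"
  using assms
proof (induction n arbitrary: t)
  case 0
  then have "1 \<le> exp (L * t)" using lipschitz_on_nonneg[OF F] by simp
  then show ?case using mult_left_mono[of 1 "exp (L * t)" "dist x y"] by simp
next
  case (Suc n)
  let ?I = "\<lambda>x. integral {0..t} (\<lambda>s. F (picard_iterate F x n s))"
  have bd: "dist (F (picard_iterate F x n s)) (F (picard_iterate F y n s))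
      \<le> dist x y * (L * exp (L * s))" if "s \<in> {0..t}" for s
  proof -
    have "dist (F (picard_iterate F x n s)) (F (picard_iterate F y n s))
        \<le> L * dist (picard_iterate F x n s) (picard_iterate F y n s)"
      using lipschitz_onD[OF F] by auto
    also have "\<dots> \<le> L * (dist x y * exp (L * s))"
      using Suc.IH[of s] that Suc.prems lipschitz_on_nonneg[OF F] by (intro mult_left_mono) auto
    finally show ?thesis by (simp add: algebra_simps)
  qed
  have "dist (picard_iterate F x (Suc n) t) (picard_iterate F y (Suc n) t) \<le> dist x y + dist (?I x) (?I y)"
    by (simp add: dist_triangle_add)
  also have "dist (?I x) (?I y) \<le> dist x y * (exp (L * t) - 1)"
    using Suc.prems bd
    by (intro dist_integral_le_exp continuous_on_lipschitz_picard_iterate) auto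
  finally show ?case by (simp add: algebra_simps)
qed

text \<open>The iterates are partial sums of a telescoping series. Bounding the weight by its value
  at \<open>T\<close> turns the contraction estimate into a geometric majorant.\<close>

lemma picard_iterate_uniform_limit:
  assumes "L > 0" "T \<ge> 0"
  shows "\<exists>\<phi>. uniform_limit {0..T} (picard_iterate F x) \<phi> sequentially"
proof -
  let ?P = "picard_iterate F x"
  define M where "M n = norm (F x) * T * exp (2 * L * T) * (1/2) ^ n" for n :: nat
  have "summable M" unfolding M_def by (intro summable_mult summable_geometric) auto
  moreover have "norm (?P (Suc n) t - ?P n t) \<le> M n" if "t \<in> {0..T}" for n t
  proof -
    have "exp (2 * L * t) \<le> exp (2 * L * T)" using that \<open>L > 0\<close> by simp
    then have "norm (F x) * T * (1/2) ^ n * exp (2 * L * t) \<le> norm (F x) * T * (1/2) ^ n * exp (2 * L * T)"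
      using \<open>T \<ge> 0\<close> by (intro mult_left_mono) auto
    also have "\<dots> = M n" by (simp add: M_def)
    finally have "norm (F x) * T * (1/2) ^ n * exp (2 * L * t) \<le> M n" .
    then show ?thesis
      using picard_iterate_contraction[OF \<open>L > 0\<close> that, of x n] by (simp add: dist_norm)
  qed
  ultimately have "uniform_limit {0..T} (\<lambda>n t. \<Sum>k<n. ?P (Suc k) t - ?P k t)
      (\<lambda>t. \<Sum>k. ?P (Suc k) t - ?P k t) sequentially"
    by (intro Weierstrass_m_test) auto
  then have "uniform_limit {0..T} (\<lambda>n t. x + (\<Sum>k<n. ?P (Suc k) t - ?P k t))
      (\<lambda>t. x + (\<Sum>k. ?P (Suc k) t - ?P k t)) sequentially"
    by (intro uniform_limit_intros)
  moreover have "x + (\<Sum>k<n. ?P (Suc k) t - ?P k t) = ?P n t" for n t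
    by (subst sum_lessThan_telescope) simp
  ultimately have "uniform_limit {0..T} ?P (\<lambda>t. x + (\<Sum>k. ?P (Suc k) t - ?P k t)) sequentially"
    by simp
  then show ?thesis by blast
qed

end

text \<open>Picard-Lindeloef on the whole interval at once. Continuity in \<open>x\<close> at fixed
  \<open>t\<close> is what the shooting argument needs.\<close>

lemma lipschitz_ode_flow:
  fixes F :: "'a::banach \<Rightarrow> 'a"
  assumes F0: "L0-lipschitz_on UNIV F" and T: "T \<ge> 0"
  obtains \<Phi> :: "'a \<Rightarrow> real \<Rightarrow> 'a"
  where "\<And>x. \<Phi> x 0 = x"
    and "\<And>x t. t \<in> {0..T} \<Longrightarrow> (\<Phi> x has_vector_derivative F (\<Phi> x t)) (at t within {0..T})"
    and "\<And>t. t \<in> {0..T} \<Longrightarrow> continuous_on UNIV (\<lambda>x. \<Phi> x t)"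
proof -
  \<comment> \<open>The contraction estimate requires a strictly positive constant.\<close>
  define L where "L = max L0 1"
  have F: "L-lipschitz_on UNIV F" and L: "L > 0"
    using lipschitz_on_mono[OF F0, of UNIV L] by (auto simp: L_def)
  obtain \<Phi> where lim: "\<And>x. uniform_limit {0..T} (picard_iterate F x) (\<Phi> x) sequentially"
    using picard_iterate_uniform_limit[OF F L T] by metis
  have cont: "continuous_on {0..T} (\<Phi> x)" for x
    by (rule uniform_limit_theorem[OF _ lim])
      (auto intro!: always_eventually continuous_on_picard_iterate[OF F])
  have contF: "continuous_on {0..T} (\<lambda>s. F (\<Phi> x s))" for x
    using continuous_on_compose2[OF lipschitz_on_continuous_on[OF F] cont] by auto
  have limF: "uniform_limit {0..T} (\<lambda>n s. F (picard_iterate F x n s)) (\<lambda>s. F (\<Phi> x s)) sequentially"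
    for x
    by (rule uniform_limit_compose_uniformly_continuous_on
        [OF lim lipschitz_on_uniformly_continuous[OF F]]) auto
  \<comment> \<open>Uniform convergence allows passing to the limit under the integral in the
    recursion; the integral equation then gives the differential equation.\<close>
  have eq: "\<Phi> x t = x + integral {0..t} (\<lambda>s. F (\<Phi> x s))" if t: "t \<in> {0..T}" for x t
  proof -
    obtain I J where
        I: "\<And>n. ((\<lambda>s. F (picard_iterate F x n s)) has_integral I n) {0..t}"
      and J: "((\<lambda>s. F (\<Phi> x s)) has_integral J) {0..t}" and "I \<longlonglongrightarrow> J"
      by (rule uniform_limit_integral[OF uniform_limit_on_subset[OF limF, of "{0..t}" x]])
        (use t continuous_on_lipschitz_picard_iterate[OF F t] in auto)
    then have "(\<lambda>n. picard_iterate F x (Suc n) t) \<longlonglongrightarrow> x + J"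
      by (auto intro!: tendsto_intros simp: integral_unique[OF I])
    moreover have "(\<lambda>n. picard_iterate F x (Suc n) t) \<longlonglongrightarrow> \<Phi> x t"
      using tendsto_uniform_limitI[OF lim t] by (rule LIMSEQ_Suc)
    ultimately have "\<Phi> x t = x + J" by (rule LIMSEQ_unique[symmetric])
    then show ?thesis using J by (simp add: integral_unique)
  qed
  show thesis
  proof
    show "\<Phi> x 0 = x" for x using eq[of 0 x] T by simp
    show "(\<Phi> x has_vector_derivative F (\<Phi> x t)) (at t within {0..T})"
      if t: "t \<in> {0..T}" for x t
    proof (rule has_vector_derivative_transform[OF t eq])
      show "((\<lambda>t. x + integral {0..t} (\<lambda>s. F (\<Phi> x s))) has_vector_derivative F (\<Phi> x t))
          (at t within {0..T})"
        using integral_has_vector_derivative[OF contF t]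
        by (auto intro!: derivative_eq_intros)
    qed
    show "continuous_on UNIV (\<lambda>x. \<Phi> x t)" if t: "t \<in> {0..T}" for t
    proof (rule lipschitz_on_continuous_on, rule lipschitz_onI)
      show "dist (\<Phi> x t) (\<Phi> y t) \<le> exp (L * t) * dist x y" for x y
      proof (rule LIMSEQ_le_const2)
        show "(\<lambda>n. dist (picard_iterate F x n t) (picard_iterate F y n t)) \<longlonglongrightarrow> dist (\<Phi> x t) (\<Phi> y t)"
          using lim t by (intro tendsto_dist tendsto_uniform_limitI)
        show "\<exists>N. \<forall>n\<ge>N. dist (picard_iterate F x n t) (picard_iterate F y n t) \<le> exp (L * t) * dist x y"
          using picard_iterate_lipschitz[OF F t] by (simp add: mult.commute)
      qed
    qed simp
  qed
qed

subsection \<open>Regularity of the Hamiltonian and its minimizer\<close>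

context two_state_costs
begin

lemma alpha_star_nonneg: "i \<in> {0,1} \<Longrightarrow> \<theta> \<in> {0..1} \<Longrightarrow> alpha_star c p \<theta> i \<ge> 0"
  using alpha_star_minimizer by (auto simp: is_arg_min_linorder)

lemma hamiltonian_le:
  assumes "i \<in> {0,1}" "\<theta> \<in> {0..1}" "\<alpha> \<ge> 0"
  shows "hamiltonian c p \<theta> i \<le> c i \<theta> \<alpha> + \<alpha> * p"
  using alpha_star_minimizer[OF assms(1,2), of p] assms
  by (auto simp: hamiltonian_eq is_arg_min_linorder)

lemma hamiltonian_nonneg:
  assumes "i \<in> {0,1}" "\<theta> \<in> {0..1}" "p \<ge> 0"
  shows "hamiltonian c p \<theta> i \<ge> 0"
  using assms alpha_star_nonneg c_nonneg by (simp add: hamiltonian_eq)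

text \<open>First-order optimality on the half-line. A failure means that moving from the minimizer
  towards \<open>y\<close>, which stays in the domain, strictly decreases the objective.\<close>

lemma alpha_star_variational:
  assumes i: "i \<in> {0,1}" and th: "\<theta> \<in> {0..1}" and "y \<ge> 0"
  shows "(c' i \<theta> (alpha_star c p \<theta> i) + p) * (y - alpha_star c p \<theta> i) \<ge> 0"
proof (rule ccontr)
  define a where "a = alpha_star c p \<theta> i"
  define l where "l = c' i \<theta> a + p"
  define f where "f = (\<lambda>\<alpha>. c i \<theta> \<alpha> + \<alpha> * p)"
  have a: "a \<ge> 0" and min: "\<And>x. x \<ge> 0 \<Longrightarrow> f a \<le> f x"
    using alpha_star_minimizer[OF i th, of p] by (auto simp: a_def f_def is_arg_min_linorder)
  have der: "(f has_real_derivative l) (at a within {0..})"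
    unfolding f_def l_def using c_deriv[OF i th a] by (auto intro!: derivative_eq_intros)
  assume "\<not> ?thesis"
  then consider "l < 0" "y > a" | "l > 0" "y < a"
    by (auto simp: a_def l_def not_le mult_less_0_iff)
  then show False
  proof cases
    case 1
    obtain d where "d > 0" "\<And>h. h > 0 \<Longrightarrow> a + h \<in> {0..} \<Longrightarrow> h < d \<Longrightarrow> f (a + h) < f a"
      using has_real_derivative_neg_dec_right[OF der 1(1)] by blast
    from this(2)[of "d/2"] this(1) min[of "a + d/2"] a show False by auto
  next
    case 2
    obtain d where "d > 0" "\<And>h. h > 0 \<Longrightarrow> a - h \<in> {0..} \<Longrightarrow> h < d \<Longrightarrow> f (a - h) < f a"
      using has_real_derivative_pos_inc_left[OF der 2(1)] by blast
    \<comment> \<open>The step is short enough for the local decrease and keeps \<open>a - h\<close>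
      nonnegative; \<open>a > 0\<close> because \<open>0 \<le> y < a\<close>.\<close>
    define h where "h = min (d/2) a"
    have "h > 0" "h < d" "h \<le> a" using \<open>d > 0\<close> 2 \<open>y \<ge> 0\<close> by (auto simp: h_def)
    then show False
      using min[of "a - h"] \<open>\<And>h. h > 0 \<Longrightarrow> a - h \<in> {0..} \<Longrightarrow> h < d \<Longrightarrow> f (a - h) < f a\<close>[of h] by auto
  qed
qed

text \<open>
  Adding the variational inequalities of two minimizers and using that uniform convexity makes
  \<open>c'\<close> strongly monotone bounds \<open>2 * \<kappa> * (a - b)\<^sup>2\<close> by the data difference times \<open>\<bar>a - b\<bar>\<close>.
\<close>

lemma alpha_star_lipschitz:
  "\<exists>L. \<forall>i\<in>{0,1}. L-lipschitz_on (UNIV \<times> {0..1}) (\<lambda>(p, \<theta>). alpha_star c p \<theta> i)"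
proof -
  obtain L where L: "\<And>i \<alpha>. i \<in> {0,1} \<Longrightarrow> \<alpha> \<ge> 0 \<Longrightarrow> L-lipschitz_on {0..1} (\<lambda>\<theta>. c' i \<theta> \<alpha>)"
    using c'_lipschitz by meson
  have L0: "L \<ge> 0" using lipschitz_on_nonneg[OF L[of 0 0]] by simp
  obtain \<kappa> where k: "\<kappa> > 0" and cvx: "\<And>i \<theta> x y. i \<in> {0,1} \<Longrightarrow> \<theta> \<in> {0..1} \<Longrightarrow> x \<ge> 0 \<Longrightarrow> y \<ge> 0 \<Longrightarrow>
      c i \<theta> y \<ge> c i \<theta> x + c' i \<theta> x * (y - x) + \<kappa> * \<bar>y - x\<bar>\<^sup>2"
    using c_uniformly_convex by meson
  \<comment> \<open>In the constant, \<open>L\<close> accounts for the change of \<open>c'\<close>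
    with \<theta>, \<open>1\<close> for the change of the price, and \<open>2 * \<kappa>\<close> is
    the strong monotonicity of \<open>c'\<close>.\<close>
  have main: "dist (alpha_star c p \<theta> i) (alpha_star c q \<eta> i) \<le> (L + 1) / (2 * \<kappa>) * dist (p, \<theta>) (q, \<eta>)"
    if i: "i \<in> {0,1}" and th: "\<theta> \<in> {0..1}" and et: "\<eta> \<in> {0..1}" for i p q \<theta> \<eta>
  proof -
    define a b where "a = alpha_star c p \<theta> i" and "b = alpha_star c q \<eta> i"
    have a: "a \<ge> 0" and b: "b \<ge> 0" using alpha_star_nonneg i th et by (auto simp: a_def b_def)
    have 1: "(c' i \<theta> a + p) * (b - a) \<ge> 0" "(c' i \<eta> b + q) * (a - b) \<ge> 0"
      using alpha_star_variational[OF i th b] alpha_star_variational[OF i et a]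
      by (simp_all add: a_def b_def)
    \<comment> \<open>The values of \<open>c\<close> cancel when the two convexity inequalities are
      added.\<close>
    have 2: "(c' i \<theta> a - c' i \<theta> b) * (a - b) \<ge> 2 * \<kappa> * (a - b)\<^sup>2"
      using cvx[OF i th a b] cvx[OF i th b a] by (simp add: algebra_simps power2_commute[of b a])
    have "2 * \<kappa> * (a - b)\<^sup>2 \<le> (c' i \<theta> b - c' i \<eta> b + (p - q)) * (b - a)"
      using 1 2 by (simp add: algebra_simps)
    also have "\<dots> \<le> \<bar>c' i \<theta> b - c' i \<eta> b + (p - q)\<bar> * \<bar>a - b\<bar>"
      by (metis abs_ge_self abs_mult abs_minus_commute)
    also have "\<dots> \<le> ((L + 1) * dist (p, \<theta>) (q, \<eta>)) * \<bar>a - b\<bar>"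
    proof (rule mult_right_mono)
      have "\<bar>c' i \<theta> b - c' i \<eta> b\<bar> \<le> L * dist \<theta> \<eta>"
        using lipschitz_onD[OF L[OF i b] th et] by (simp add: dist_real_def)
      also have "\<dots> \<le> L * dist (p, \<theta>) (q, \<eta>)"
        using L0 dist_snd_le[of "(p, \<theta>)" "(q, \<eta>)"] by (intro mult_left_mono) auto
      finally have "\<bar>c' i \<theta> b - c' i \<eta> b\<bar> \<le> L * dist (p, \<theta>) (q, \<eta>)" .
      moreover have "\<bar>p - q\<bar> \<le> dist (p, \<theta>) (q, \<eta>)"
        using dist_fst_le[of "(p, \<theta>)" "(q, \<eta>)"] by (simp add: dist_real_def)
      ultimately show "\<bar>c' i \<theta> b - c' i \<eta> b + (p - q)\<bar> \<le> (L + 1) * dist (p, \<theta>) (q, \<eta>)"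
        by (simp add: algebra_simps)
    qed simp
    finally have "(2 * \<kappa> * \<bar>a - b\<bar>) * \<bar>a - b\<bar> \<le> ((L + 1) * dist (p, \<theta>) (q, \<eta>)) * \<bar>a - b\<bar>"
      by (simp add: power2_eq_square mult.assoc flip: abs_mult)
    then have "2 * \<kappa> * \<bar>a - b\<bar> \<le> (L + 1) * dist (p, \<theta>) (q, \<eta>)"
      using L0 by (cases "a = b") auto
    then show ?thesis
      using k by (simp add: dist_real_def field_simps flip: a_def b_def)
  qed
  have "\<forall>i\<in>{0,1}. ((L + 1) / (2 * \<kappa>))-lipschitz_on (UNIV \<times> {0..1}) (\<lambda>(p, \<theta>). alpha_star c p \<theta> i)"
    using main L0 k by (intro ballI lipschitz_onI) force+
  then show ?thesis by blast
qed

text \<open>Continuity on a compact rectangle. The resulting bound limits both the slope of the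
  Hamiltonian in \<open>p\<close> and the speed of \<theta>.\<close>

lemma alpha_star_bounded:
  "\<exists>K. \<forall>i\<in>{0,1}. \<forall>p\<in>{-M..M}. \<forall>\<theta>\<in>{0..1}. alpha_star c p \<theta> i \<le> K"
proof -
  obtain L where L: "\<forall>i\<in>{0,1}. L-lipschitz_on (UNIV \<times> {0..1}) (\<lambda>(p, \<theta>). alpha_star c p \<theta> i)"
    using alpha_star_lipschitz by blast
  have "bounded ((\<lambda>(p, \<theta>). alpha_star c p \<theta> i) ` ({-M..M} \<times> {0..1}))" if "i \<in> {0,1}" for i
    using L that
    by (intro compact_imp_bounded compact_continuous_image compact_Times)
      (auto intro: lipschitz_on_continuous_on lipschitz_on_subset)
  then have "\<exists>K. \<forall>p\<in>{-M..M}. \<forall>\<theta>\<in>{0..1}. alpha_star c p \<theta> i \<le> K" if "i \<in> {0,1}" for i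
    using that unfolding bounded_iff by (fastforce dest: abs_le_D1)
  then obtain K where "\<And>i p \<theta>. i \<in> {0,1} \<Longrightarrow> p \<in> {-M..M} \<Longrightarrow> \<theta> \<in> {0..1} \<Longrightarrow> alpha_star c p \<theta> i \<le> K i"
    by metis
  then have "\<forall>i\<in>{0,1}. \<forall>p\<in>{-M..M}. \<forall>\<theta>\<in>{0..1}. alpha_star c p \<theta> i \<le> max (K 0) (K 1)"
    by (fastforce simp: le_max_iff_disj)
  then show ?thesis by blast
qed

text \<open>
  The Lipschitz constant of \<open>c\<close> in \<open>\<theta>\<close> may depend on \<open>\<alpha>\<close>; the uniform one of \<open>c'\<close> shows that
  it grows at most linearly.
\<close>

lemma c_lipschitz_linear_growth:
  assumes i: "i \<in> {0,1}"
  shows "\<exists>A L. A \<ge> 0 \<and> L \<ge> 0 \<and>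
    (\<forall>\<theta>\<in>{0..1}. \<forall>\<eta>\<in>{0..1}. \<forall>\<alpha>\<ge>0. \<bar>c i \<theta> \<alpha> - c i \<eta> \<alpha>\<bar> \<le> (A + L * \<alpha>) * \<bar>\<theta> - \<eta>\<bar>)"
proof -
  obtain L where L: "\<And>\<alpha>. \<alpha> \<ge> 0 \<Longrightarrow> L-lipschitz_on {0..1} (\<lambda>\<theta>. c' i \<theta> \<alpha>)"
    using c'_lipschitz i by meson
  obtain A where A: "A-lipschitz_on {0..1} (\<lambda>\<theta>. c i \<theta> 0)"
    using c_lipschitz[OF i, of 0] by auto
  have "\<bar>c i \<theta> \<alpha> - c i \<eta> \<alpha>\<bar> \<le> (A + L * \<alpha>) * \<bar>\<theta> - \<eta>\<bar>"
    if th: "\<theta> \<in> {0..1}" and et: "\<eta> \<in> {0..1}" and al: "\<alpha> \<ge> 0" for \<theta> \<eta> \<alpha>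
  proof -
    \<comment> \<open>The mean value inequality in the control variable: the derivative of
      \<open>g\<close> is at most \<open>L * \<bar>\<theta> - \<eta>\<bar>\<close>, and
      \<open>g 0\<close> is controlled by \<open>A\<close>.\<close>
    define g where "g = (\<lambda>\<beta>. c i \<theta> \<beta> - c i \<eta> \<beta>)"
    have "norm (g \<alpha> - g 0) \<le> (L * \<bar>\<theta> - \<eta>\<bar>) * norm (\<alpha> - 0)"
    proof (rule field_differentiable_bound[of "{0..}"])
      show "(g has_real_derivative c' i \<theta> z - c' i \<eta> z) (at z within {0..})" if "z \<in> {0..}" for z
        unfolding g_def using c_deriv[OF i th, of z] c_deriv[OF i et, of z] that
        by (auto intro!: derivative_eq_intros)
      show "norm (c' i \<theta> z - c' i \<eta> z) \<le> L * \<bar>\<theta> - \<eta>\<bar>" if "z \<in> {0..}" for z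
        using lipschitz_onD[OF L th et, of z] that by (simp add: dist_real_def)
    qed (use al in auto)
    moreover have "\<bar>g 0\<bar> \<le> A * \<bar>\<theta> - \<eta>\<bar>"
      using lipschitz_onD[OF A th et] by (simp add: g_def dist_real_def)
    ultimately have "\<bar>g \<alpha>\<bar> \<le> A * \<bar>\<theta> - \<eta>\<bar> + L * \<bar>\<theta> - \<eta>\<bar> * \<alpha>"
      using al by simp
    then show ?thesis by (simp add: g_def algebra_simps)
  qed
  then show ?thesis
    using lipschitz_on_nonneg[OF A] lipschitz_on_nonneg[OF L[of 0]]
    by (intro exI[of _ A] exI[of _ L] conjI) simp_all
qed

text \<open>The minimizer for one pair of arguments is a competitor for the other, which bounds the
  difference from one side; exchanging the pairs gives the other side. Bounded prices keep these
  minimizers bounded.\<close>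

lemma hamiltonian_lipschitz:
  assumes i: "i \<in> {0,1}"
  shows "\<exists>L. L-lipschitz_on ({-M..M} \<times> {0..1}) (\<lambda>(p, \<theta>). hamiltonian c p \<theta> i)"
proof -
  obtain K where K: "\<And>p \<theta>. p \<in> {-M..M} \<Longrightarrow> \<theta> \<in> {0..1} \<Longrightarrow> alpha_star c p \<theta> i \<le> K"
    using alpha_star_bounded[of M] i by blast
  obtain A L where "A \<ge> 0" "L \<ge> 0" and AL: "\<And>\<theta> \<eta> \<alpha>. \<theta> \<in> {0..1} \<Longrightarrow> \<eta> \<in> {0..1} \<Longrightarrow> \<alpha> \<ge> 0 \<Longrightarrow>
      \<bar>c i \<theta> \<alpha> - c i \<eta> \<alpha>\<bar> \<le> (A + L * \<alpha>) * \<bar>\<theta> - \<eta>\<bar>"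
    using c_lipschitz_linear_growth[OF i] by blast
  \<comment> \<open>The first two terms come from \<theta>, the last from \<open>p\<close>. For
    negative \<open>M\<close> the interval is empty and \<open>K\<close> is arbitrary;
    \<open>max 0 K\<close> keeps \<open>B\<close> nonnegative.\<close>
  define B where "B = A + L * max 0 K + max 0 K"
  have one: "hamiltonian c p \<theta> i - hamiltonian c q \<eta> i \<le> B * dist (p, \<theta>) (q, \<eta>)"
    if p: "p \<in> {-M..M}" and q: "q \<in> {-M..M}" and th: "\<theta> \<in> {0..1}" and et: "\<eta> \<in> {0..1}" for p q \<theta> \<eta>
  proof -
    define b where "b = alpha_star c q \<eta> i"
    have b: "0 \<le> b" "b \<le> max 0 K"
      using alpha_star_nonneg[OF i et, of q] K[OF q et] by (auto simp: b_def)
    have "hamiltonian c p \<theta> i - hamiltonian c q \<eta> i \<le> (c i \<theta> b - c i \<eta> b) + b * (p - q)"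
      using hamiltonian_le[OF i th b(1), of p] hamiltonian_eq[OF i et, of q]
      by (simp add: b_def algebra_simps)
    also have "c i \<theta> b - c i \<eta> b \<le> (A + L * b) * \<bar>\<theta> - \<eta>\<bar>"
      using AL[OF th et b(1)] by simp
    also have "\<dots> \<le> (A + L * max 0 K) * dist (p, \<theta>) (q, \<eta>)"
      using b \<open>A \<ge> 0\<close> \<open>L \<ge> 0\<close> dist_snd_le[of "(p, \<theta>)" "(q, \<eta>)"]
      by (intro mult_mono add_left_mono mult_left_mono) (auto simp: dist_real_def)
    also have "b * (p - q) \<le> max 0 K * dist (p, \<theta>) (q, \<eta>)"
    proof -
      have "b * (p - q) \<le> b * \<bar>p - q\<bar>" using b by (intro mult_left_mono) auto
      also have "\<dots> \<le> max 0 K * dist (p, \<theta>) (q, \<eta>)"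
        using b dist_fst_le[of "(p, \<theta>)" "(q, \<eta>)"] by (intro mult_mono) (auto simp: dist_real_def)
      finally show ?thesis .
    qed
    finally show ?thesis by (simp add: B_def algebra_simps)
  qed
  have "B-lipschitz_on ({-M..M} \<times> {0..1}) (\<lambda>(p, \<theta>). hamiltonian c p \<theta> i)"
  proof (rule lipschitz_onI)
    show "0 \<le> B" using \<open>A \<ge> 0\<close> \<open>L \<ge> 0\<close> by (simp add: B_def)
    fix x y assume "x \<in> {-M..M} \<times> {0..1::real}" "y \<in> {-M..M} \<times> {0..1::real}"
    then show "dist ((\<lambda>(p, \<theta>). hamiltonian c p \<theta> i) x) ((\<lambda>(p, \<theta>). hamiltonian c p \<theta> i) y) \<le> B * dist x y"
      using one[of "fst x" "fst y" "snd x" "snd y"] one[of "fst y" "fst x" "snd y" "snd x"]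
      by (auto simp: dist_real_def[of "hamiltonian _ _ _ _"] dist_commute abs_le_iff)
  qed
  then show ?thesis by blast
qed

end

subsection \<open>Shooting in the terminal value\<close>

theorem proposition3:
  fixes c c' :: "nat \<Rightarrow> real \<Rightarrow> real \<Rightarrow> real"
    and \<psi> :: "nat \<Rightarrow> real \<Rightarrow> real"
    and T \<theta>\<^sub>0 :: real
  assumes "two_state_costs c c' \<psi>"
    and "T > 0"
    and "\<theta>\<^sub>0 \<in> {0..1}"
  shows "\<exists>(u :: nat \<Rightarrow> real \<Rightarrow> real) (\<theta> :: real \<Rightarrow> real).
    (\<forall>t\<in>{0..T}. \<theta> t \<in> {0..1}) \<and>
    (\<forall>i\<in>{0,1}. \<forall>t\<in>{0..T}.
       (u i has_real_derivative - hamiltonian c (u (1 - i) t - u i t) (\<theta> t) i)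
         (at t within {0..T})) \<and>
    (\<forall>t\<in>{0..T}.
       (\<theta> has_real_derivative
          (1 - \<theta> t) * alpha_star c (u 0 t - u 1 t) (\<theta> t) 1
          - \<theta> t * alpha_star c (u 1 t - u 0 t) (\<theta> t) 0)
         (at t within {0..T})) \<and>
    (\<forall>i\<in>{0,1}. u i T = \<psi> i (\<theta> T)) \<and>
    \<theta> 0 = \<theta>\<^sub>0"
proof -
  interpret two_state_costs c c' \<psi> by fact
  have T: "T > 0" by fact
  obtain C where C: "\<And>i \<theta>. i \<in> {0,1} \<Longrightarrow> \<theta> \<in> {0..1} \<Longrightarrow> c i \<theta> 0 \<le> C"
    using lipschitz_on_two_states_bounded_above[of "\<lambda>i \<theta>. c i \<theta> 0"] c_lipschitz by blast
  obtain P where P: "\<And>i \<theta>. i \<in> {0,1} \<Longrightarrow> \<theta> \<in> {0..1} \<Longrightarrow> \<psi> i \<theta> \<le> P"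
    using lipschitz_on_two_states_bounded_above[of \<psi>] psi_lipschitz by blast
  have "C \<ge> 0" "P \<ge> 0"
    using order_trans[OF c_nonneg C, of 0 0] order_trans[OF psi_nonneg P, of 0 0] by auto
  \<comment> \<open>\<open>-du/dt \<le> c i \<theta> 0 \<le> C\<close> and \<open>\<psi> \<le> P\<close> give the a priori bound \<open>u \<le> M\<close>\<close>
  define M where "M = P + C * T"
  have M: "M \<ge> 0" using \<open>C \<ge> 0\<close> \<open>P \<ge> 0\<close> T by (simp add: M_def)
  obtain K where K: "\<And>i p \<theta>. i \<in> {0,1} \<Longrightarrow> p \<in> {-M..M} \<Longrightarrow> \<theta> \<in> {0..1} \<Longrightarrow> alpha_star c p \<theta> i \<le> K"
    using alpha_star_bounded[of M] by blast
  obtain LA where LA: "\<And>i. i \<in> {0,1} \<Longrightarrow>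
      LA-lipschitz_on (UNIV \<times> {0..1}) (\<lambda>(p, \<theta>). alpha_star c p \<theta> i)"
    using alpha_star_lipschitz by blast

  \<comment> \<open>A point \<open>v\<close> holds \<open>(u 0, u 1, \<theta>)\<close>;
    \<open>w\<close> and \<open>e\<close> are its truncated components, \<open>A i\<close> is the
    jump rate out of state \<open>i\<close>, and \<open>D\<close> is the drift of \<theta> in
    original time. Reversing time removes the minus sign of the \<open>u\<close> equations and puts
    one on \<open>D\<close>.\<close>
  define y where "y i v = (if i = 0 then fst v else fst (snd v))" for i :: nat and v :: "real \<times> real \<times> real"
  define w where "w i v = truncate 0 M (y i v)" for i v
  define e where "e v = truncate 0 1 (snd (snd v))" for v :: "real \<times> real \<times> real"
  define p where "p i v = w (1 - i) v - w i v" for i v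
  define H where "H i v = hamiltonian c (p i v) (e v) i" for i v
  define A where "A i v = alpha_star c (p i v) (e v) i" for i v
  define D where "D v = (1 - e v) * A 1 v - e v * A 0 v" for v
  define F where "F v = (H 0 v, H 1 v, - D v)" for v

  have e: "e v \<in> {0..1}" for v by (simp only: e_def truncate_in[of 0 1])
  have w: "w i v \<in> {0..M}" for i v by (simp only: w_def truncate_in[OF M])
  have p: "p i v \<in> {-M..M}" for i v
    using w[of i v] w[of "1 - i" v] by (simp add: p_def)
  have A: "0 \<le> A i v" "A i v \<le> K" if "i \<in> {0,1}" for i v
    using alpha_star_nonneg[OF that e] K[OF that p e] by (auto simp: A_def)

  have y_lip: "1-lipschitz_on UNIV (y i)" for i
  proof (rule lipschitz_onI)
    show "dist (y i v) (y i v') \<le> 1 * dist v v'" for v v'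
      using dist_fst_le[of v v'] dist_snd_le[of v v'] dist_fst_le[of "snd v" "snd v'"]
      by (auto simp: y_def)
  qed simp
  have "1-lipschitz_on UNIV (\<lambda>v :: real \<times> real \<times> real. snd (snd v))"
  proof (rule lipschitz_onI)
    show "dist (snd (snd v)) (snd (snd v')) \<le> 1 * dist v v'" for v v' :: "real \<times> real \<times> real"
      using dist_snd_le[of v v'] dist_snd_le[of "snd v" "snd v'"] by simp
  qed simp
  then have e_lip: "1-lipschitz_on UNIV e"
    unfolding e_def by (rule lipschitz_on_truncate)
  have "2-lipschitz_on UNIV (p i)" for i
    using lipschitz_on_diff[OF lipschitz_on_truncate[OF y_lip] lipschitz_on_truncate[OF y_lip]]
    by (simp add: p_def w_def)
  \<comment> \<open>The product metric combines the constants \<open>2\<close> and \<open>1\<close>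
    into \<open>sqrt (2\<^sup>2 + 1\<^sup>2)\<close>.\<close>
  from lipschitz_on_Pair[OF this e_lip]
  have pe: "(sqrt 5)-lipschitz_on UNIV (\<lambda>v. (p i v, e v))" for i by simp
  have H_lip: "\<exists>L. L-lipschitz_on UNIV (H i)" if i: "i \<in> {0,1}" for i
  proof -
    obtain L where "L-lipschitz_on ({-M..M} \<times> {0..1}) (\<lambda>(p, \<theta>). hamiltonian c p \<theta> i)"
      using hamiltonian_lipschitz[OF i] by blast
    then have "L-lipschitz_on (range (\<lambda>v. (p i v, e v))) (\<lambda>(p, \<theta>). hamiltonian c p \<theta> i)"
      by (rule lipschitz_on_subset) (use p e in blast)
    from lipschitz_on_compose2[OF pe this] show ?thesis by (auto simp: H_def)
  qed
  have A_lip: "\<exists>L. L-lipschitz_on UNIV (A i)" if i: "i \<in> {0,1}" for i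
  proof -
    have "LA-lipschitz_on (range (\<lambda>v. (p i v, e v))) (\<lambda>(p, \<theta>). alpha_star c p \<theta> i)"
      by (rule lipschitz_on_subset[OF LA[OF i]]) (use e in blast)
    from lipschitz_on_compose2[OF pe this] show ?thesis by (auto simp: A_def)
  qed
  obtain L0 L1 where L01: "L0-lipschitz_on UNIV (A 0)" "L1-lipschitz_on UNIV (A 1)"
    using A_lip by blast
  have "K \<ge> 0" using order_trans[OF A(1) A(2), of 0] by auto
  have abs_A: "\<bar>A i v\<bar> \<le> K" if "i \<in> {0,1}" for i v using A[OF that, of v] by simp
  have abs_e: "\<bar>e v\<bar> \<le> 1" "\<bar>1 - e v\<bar> \<le> 1" for v using e[of v] by auto
  have "(0 + 1)-lipschitz_on UNIV (\<lambda>v. 1 - e v)"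
    by (intro lipschitz_intros e_lip)
  then have "(1 * L1 + K * (0 + 1))-lipschitz_on UNIV (\<lambda>v. (1 - e v) * A 1 v)"
    by (rule lipschitz_on_mult_bounded[OF _ L01(2)]) (simp_all add: abs_A abs_e \<open>K \<ge> 0\<close>)
  moreover have "(1 * L0 + K * 1)-lipschitz_on UNIV (\<lambda>v. e v * A 0 v)"
    by (rule lipschitz_on_mult_bounded[OF e_lip L01(1)]) (simp_all add: abs_A abs_e \<open>K \<ge> 0\<close>)
  ultimately have "\<exists>L. L-lipschitz_on UNIV D"
    unfolding D_def by (intro exI) (rule lipschitz_on_diff)
  then obtain L2 where "L2-lipschitz_on UNIV D" by blast
  moreover obtain L3 L4 where "L3-lipschitz_on UNIV (H 0)" "L4-lipschitz_on UNIV (H 1)"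
    using H_lip by blast
  ultimately have "\<exists>L. L-lipschitz_on UNIV F"
    unfolding F_def by (intro exI) (rule lipschitz_on_Pair lipschitz_on_minus | assumption)+
  then obtain L where "L-lipschitz_on UNIV F" by blast
  then obtain \<Phi> where \<Phi>0: "\<And>x. \<Phi> x 0 = x"
    and \<Phi>: "\<And>x t. t \<in> {0..T} \<Longrightarrow> (\<Phi> x has_vector_derivative F (\<Phi> x t)) (at t within {0..T})"
    and \<Phi>_cont: "\<And>t. t \<in> {0..T} \<Longrightarrow> continuous_on UNIV (\<lambda>x. \<Phi> x t)"
    using lipschitz_ode_flow[of L F T] T by (metis less_imp_le)

  have y_deriv: "((\<lambda>s. y i (\<Phi> z s)) has_real_derivative H i (\<Phi> z s)) (at s within {0..T})"
    if "i \<in> {0,1}" "s \<in> {0..T}" for i z s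
    using that(1) bounded_linear.has_vector_derivative[OF bounded_linear_fst \<Phi>[OF that(2)], of z]
      bounded_linear.has_vector_derivative[OF bounded_linear_compose[OF bounded_linear_fst bounded_linear_snd]
        \<Phi>[OF that(2)], of z]
    by (auto simp: y_def F_def has_real_derivative_iff_has_vector_derivative)
  have th_deriv: "((\<lambda>s. snd (snd (\<Phi> z s))) has_real_derivative - D (\<Phi> z s)) (at s within {0..T})"
    if "s \<in> {0..T}" for z s
    using bounded_linear.has_vector_derivative[OF bounded_linear_compose[OF bounded_linear_snd bounded_linear_snd]
        \<Phi>[OF that], of z]
    by (auto simp: F_def has_real_derivative_iff_has_vector_derivative)

  \<comment> \<open>\<open>\<xi> x\<close> is the terminal datum for \<open>\<theta> T = x\<close>,
    and \<open>\<eta> x\<close> the value of \<theta> then reached at original time 0. Since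
    \<open>x\<close> ranges over all reals, only the argument of \<psi> is truncated.\<close>
  define \<xi> where "\<xi> x = (\<psi> 0 (truncate 0 1 x), \<psi> 1 (truncate 0 1 x), x)" for x
  define \<eta> where "\<eta> x = snd (snd (\<Phi> (\<xi> x) T))" for x
  have trunc: "continuous_on UNIV (truncate 0 1)"
    by (rule lipschitz_on_continuous_on[OF lipschitz_on_truncate[OF lipschitz_on_id]])
  have "continuous_on UNIV (\<lambda>x. \<psi> i (truncate 0 1 x))" if i: "i \<in> {0,1}" for i
  proof -
    obtain L where "L-lipschitz_on {0..1} (\<psi> i)" using psi_lipschitz[OF i] by blast
    then have "continuous_on {0..1} (\<psi> i)" by (rule lipschitz_on_continuous_on)
    then show ?thesis
      by (rule continuous_on_compose2[OF _ trunc]) (use truncate_in[of 0 1] in auto)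
  qed
  then have "continuous_on UNIV \<xi>"
    unfolding \<xi>_def by (intro continuous_on_Pair continuous_on_id) auto
  then have "continuous_on UNIV (\<lambda>x. \<Phi> (\<xi> x) T)"
    using \<Phi>_cont[of T] T by (intro continuous_on_compose2[of UNIV "\<lambda>x. \<Phi> x T" _ \<xi>]) auto
  then have \<eta>_cont: "continuous_on S \<eta>" for S
    unfolding \<eta>_def
    by (intro continuous_on_snd) (auto intro: continuous_on_subset)
  \<comment> \<open>\<open>D\<close> is a difference of two numbers in \<open>{0..K}\<close>, so its
    absolute value is at most \<open>K\<close>.\<close>
  have \<eta>_near: "\<bar>\<eta> x - x\<bar> \<le> K * T" for x
  proof -
    have "\<bar>D v\<bar> \<le> K" for v
    proof -
      have "(1 - e v) * A 1 v \<in> {0..1 * K}" "e v * A 0 v \<in> {0..1 * K}"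
        using e[of v] A[of 0 v] A[of 1 v]
          mult_mono[of "1 - e v" 1 "A 1 v" K] mult_mono[of "e v" 1 "A 0 v" K] by simp_all
      then show ?thesis by (auto simp: D_def)
    qed
    then have "norm (snd (snd (\<Phi> (\<xi> x) T)) - snd (snd (\<Phi> (\<xi> x) 0))) \<le> K * norm (T - 0)"
      using T by (intro field_differentiable_bound[OF _ th_deriv]) auto
    then show ?thesis using T by (simp add: \<eta>_def \<Phi>0 \<xi>_def)
  qed
  have "K * T \<ge> 0" using \<eta>_near[of 0] by linarith
  \<comment> \<open>At the left endpoint \<eta> is at most 0, at the right one at least 1, so these
    bracket \<open>\<theta>\<^sub>0\<close>.\<close>
  then have "\<exists>x. - (K * T) \<le> x \<and> x \<le> 1 + K * T \<and> \<eta> x = \<theta>\<^sub>0"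
    using \<eta>_near[of "- (K * T)"] \<eta>_near[of "1 + K * T"] \<open>\<theta>\<^sub>0 \<in> {0..1}\<close>
    by (intro IVT' \<eta>_cont) (auto simp: abs_le_iff)
  then obtain x where x: "\<eta> x = \<theta>\<^sub>0" by blast

  define v where "v = \<Phi> (\<xi> x)"
  define \<theta> where "\<theta> t = snd (snd (v (T - t)))" for t
  define u where "u i t = y i (v (T - t))" for i t
  have \<theta>_deriv: "(\<theta> has_real_derivative D (v (T - t))) (at t within {0..T})" if "t \<in> {0..T}" for t
    using has_real_derivative_reflect[OF th_deriv that, of "\<xi> x"] unfolding \<theta>_def v_def by simp
  have u_deriv: "(u i has_real_derivative - H i (v (T - t))) (at t within {0..T})"
    if "i \<in> {0,1}" "t \<in> {0..T}" for i t
    using has_real_derivative_reflect[OF y_deriv[OF that(1)] that(2), of "\<xi> x"]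
    unfolding u_def v_def by simp
  have \<theta>0: "\<theta> 0 = \<theta>\<^sub>0" using x by (simp add: \<theta>_def v_def \<eta>_def)
  have \<theta>T: "\<theta> T = x" by (simp add: \<theta>_def v_def \<Phi>0 \<xi>_def)

  \<comment> \<open>The barrier runs in original time, where \<theta> starts at
    \<open>\<theta>\<^sub>0\<close>. Below 0 the truncated value is 0 and
    \<open>D = A 1 \<ge> 0\<close>; above 1 it is 1 and \<open>D = - A 0 \<le> 0\<close>.\<close>
  have \<theta>_in: "\<theta> t \<in> {0..1}" if t: "t \<in> {0..T}" for t
  proof -
    have "\<theta> t \<ge> 0"
    proof (rule nonneg_if_derivative_nonneg_where_negative[OF \<theta>_deriv])
      show "D (v (T - t)) \<ge> 0" if "\<theta> t < 0" for t
        using that A[of 1] by (simp add: D_def e_def \<theta>_def truncate_below)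
    qed (use t \<theta>0 \<open>\<theta>\<^sub>0 \<in> {0..1}\<close> in auto)
    moreover have "1 - \<theta> t \<ge> 0"
    proof (rule nonneg_if_derivative_nonneg_where_negative
        [where f = "\<lambda>t. 1 - \<theta> t" and f' = "\<lambda>t. - D (v (T - t))" and T = T])
      show "((\<lambda>t. 1 - \<theta> t) has_real_derivative - D (v (T - t))) (at t within {0..T})"
        if "t \<in> {0..T}" for t
        using \<theta>_deriv[OF that] by (auto intro!: derivative_eq_intros)
      show "- D (v (T - t)) \<ge> 0" if "1 - \<theta> t < 0" for t
        using that A[of 0] by (simp add: D_def e_def \<theta>_def truncate_above)
    qed (use t \<theta>0 \<open>\<theta>\<^sub>0 \<in> {0..1}\<close> in auto)
    ultimately show ?thesis by simp
  qed
  \<comment> \<open>Only now is the truncation inside \<xi> known to be inactive, which yields the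
    genuine terminal condition.\<close>
  then have x01: "x \<in> {0..1}" using \<theta>T T by (metis atLeastAtMost_iff less_imp_le order_refl)
  have y0: "y i (v 0) = \<psi> i x" if "i \<in> {0,1}" for i
    using that x01 by (auto simp: y_def v_def \<Phi>0 \<xi>_def truncate_id)

  \<comment> \<open>This barrier runs in reversed time, from the data \<psi>. Where
    \<open>y i\<close> is negative its truncation is 0, so the price is nonnegative and so is the
    Hamiltonian. For the upper bound the competitor control 0 gives
    \<open>H i \<le> C\<close>.\<close>
  have y_in: "y i (v s) \<in> {0..M}" if i: "i \<in> {0,1}" and s: "s \<in> {0..T}" for i s
  proof -
    have "y i (v s) \<ge> 0"
    proof (rule nonneg_if_derivative_nonneg_where_negative[OF y_deriv[OF i, where z = "\<xi> x", folded v_def]])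
      show "H i (v s) \<ge> 0" if "y i (v s) < 0" for s
      proof -
        have "w i (v s) = 0" using that M by (simp add: w_def truncate_below)
        then have "p i (v s) \<ge> 0" using w[of "1 - i" "v s"] by (simp add: p_def)
        then show ?thesis using hamiltonian_nonneg[OF i e] by (simp add: H_def)
      qed
    qed (use s y0[OF i] psi_nonneg[OF i x01] in auto)
    moreover have "P + C * s - y i (v s) \<ge> 0"
    proof (rule nonneg_if_derivative_nonneg_where_negative
        [where f = "\<lambda>s. P + C * s - y i (v s)" and f' = "\<lambda>s. C - H i (v s)" and T = T])
      show "((\<lambda>s. P + C * s - y i (v s)) has_real_derivative C - H i (v s)) (at s within {0..T})"
        if "s \<in> {0..T}" for s
        using y_deriv[OF i that, of "\<xi> x"] unfolding v_def by (auto intro!: derivative_eq_intros)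
      show "C - H i (v s) \<ge> 0" for s
        using hamiltonian_le[OF i e, of 0] C[OF i e] by (smt (verit) H_def mult_zero_left)
    qed (use s y0[OF i] P[OF i x01] in auto)
    moreover have "C * s \<le> C * T" using s \<open>C \<ge> 0\<close> by (auto intro: mult_left_mono)
    ultimately show ?thesis by (simp add: M_def)
  qed
  \<comment> \<open>Along this trajectory the truncations are identities, so the truncated equations
    are the original system.\<close>
  have w_eq: "w i (v (T - t)) = u i t" if "i \<in> {0,1}" "t \<in> {0..T}" for i t
    using y_in[OF that(1), of "T - t"] that by (simp add: w_def u_def truncate_id)
  have e_eq: "e (v (T - t)) = \<theta> t" if "t \<in> {0..T}" for t
    using \<theta>_in[OF that] by (simp add: e_def \<theta>_def truncate_id)

  show ?thesis
  proof (intro exI conjI ballI)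
    show "\<theta> t \<in> {0..1}" if "t \<in> {0..T}" for t by (rule \<theta>_in[OF that])
    show "(u i has_real_derivative - hamiltonian c (u (1 - i) t - u i t) (\<theta> t) i) (at t within {0..T})"
      if "i \<in> {0,1}" "t \<in> {0..T}" for i t
    proof -
      have "1 - i \<in> {0,1}" using that by auto
      then show ?thesis using u_deriv[OF that] that by (simp only: H_def p_def w_eq e_eq)
    qed
    show "(\<theta> has_real_derivative (1 - \<theta> t) * alpha_star c (u 0 t - u 1 t) (\<theta> t) 1
        - \<theta> t * alpha_star c (u 1 t - u 0 t) (\<theta> t) 0) (at t within {0..T})"
      if "t \<in> {0..T}" for t
      using \<theta>_deriv[OF that] w_eq[of 0 t] w_eq[of 1 t] that by (simp add: D_def A_def p_def e_eq)
    show "u i T = \<psi> i (\<theta> T)" if "i \<in> {0,1}" for i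
      using y0[OF that] by (simp add: u_def \<theta>T)
    show "\<theta> 0 = \<theta>\<^sub>0" by (rule \<theta>0)
  qed
qed

end
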